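(* Let $m>1$, $N\ge 1$, and let $R^{(1)},\dots,R^{(N)}$ be an arbitrary sequence of return matrices such that, for some constant $r\in(0,1)$, $\bar r^{(k)}_{ij}+\underline r^{(k)}_{ij}\ge r$ for all $i\neq j$ in $\{1,\dots,m\}$ and all $k\in\{1,\dots,N\}$, and $\max_{i,j}(\bar r^{(k)}_{ij}+\underline r^{(k)}_{ij})=1$ for all $k$. Consider the linear prediction $R'^{(k+1)}=\sum_{l=1}^{d_k}a_{k,l}R^{(k-l+1)}$, where $1\le d_k\le k$, $a_{k,l}\ge0$ and $\sum_{l=1}^{d_k}a_{k,l}=1$. Let $\gamma>0$ and let $(i,j)$ be a pair of distinct currencies. Then: (a) For the IITC algorithm, $$R_N(\{\psi^{(k)}\},\{R^{(k)}\})-R_N^*(e_{ij},\{R^{(k)}\})\ \ge\ \frac1N\log\frac{\psi^{(1)}_{ij}}{\psi^{(N+1)}_{ij}}+\frac1N\sum_{k=1}^N\log(1-c_k)+\gamma r-\gamma .$$ (b) For the EIITC algorithm, $$R_N(\{\psi^{(k)}\},\{R^{(k)}\})-R_N^*(e_{ij},\{R^{(k)}\})\ \ge\ \frac1N\log\frac{\psi^{(1)}_{ij}}{\psi^{(N+1)}_{ij}}+\frac1N\sum_{k=1}^N\log(1-c_k)+\gamma r-\frac{\gamma}{r} .$$ (c) For the IITC algorithm, the transaction cost ratio $c_{k+1}=c_{k+1}(\gamma)$ satisfies $$c_{k+1}(\gamma)\le \frac{c\,e^{\gamma}\,\gamma}{1-c}+O(\gamma^2).$$ (d) For the EIITC algorithm,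 $$c_{k+1}(\gamma)\le \frac{c\,e^{\gamma/r}\,\gamma}{(1-c)\,r}+O(\gamma^2).$$ Here $O(\gamma^2)$ denotes a quantity for which there exist $\alpha_1,\alpha_2\in\mathbb{R}$ such that $\alpha_1\gamma^2\le O(\gamma^2)\le\alpha_2\gamma^2$ for all sufficiently small $\gamma>0$.
   Context: Return matrices. There are $m>1$ currencies. A return matrix $R^{(k)}$ records, for each ordered pair $(i,j)$ of distinct currencies, nonnegative returns $\bar r^{(k)}_{ij}$ and $\underline r^{(k)}_{ij}$ (buying/selling); only the sums $\rho^{(k)}_{ij}:=\bar r^{(k)}_{ij}+\underline r^{(k)}_{ij}$ enter below, and diagonal returns are $0$. For the prediction $R'^{(k+1)}$ the corresponding entries are $\bar r'^{(k+1)}_{ij},\underline r'^{(k+1)}_{ij}$, with sum $\rho'^{(k+1)}_{ij}$. Portfolios. A portfolio matrix is $\psi=(\psi_{ij})\in\mathbb{R}^{m\times m}$ with $\psi_{ii}=0$, $\psi_{ij}>0$ for $i\ne j$, $\sum_{i,j}\psi_{ij}=1$. For a matrix $\psi$ and a return matrix $R$ put $\psi\diamond R=\sum_{i,j=1}^m\psi_{ij}(\bar r_{ij}+\underline r_{ij})$. $e_{ij}$ is the $m\times m$ matrix with $(i,j)$ entry $1$ and all other entries $0$. Capital and transaction costs. $F_k>0$ is the capital at the end of day $k$, $T_k$ the transaction cost charged at day $k$, $F'_k=F_{k-1}-T_k$, and $F_k=F'_k(\psi^{(k)}\diamond R^{(k)})$, with $\psi^{(k)}\diamond R^{(k)}>0$.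 The proportions automatically reached at the end of day $k$ are $\psi'^{(k)}_{ij}=\frac{F'_k}{F_k}\psi^{(k)}_{ij}\rho^{(k)}_{ij}=\psi^{(k)}_{ij}\rho^{(k)}_{ij}/(\psi^{(k)}\diamond R^{(k)})$. With a fixed constant $c\in(0,1)$, the transaction cost is $T_{k+1}=c\sum_{i,j=1}^m\big|F'_{k+1}\psi^{(k+1)}_{ij}-F'_k\psi^{(k)}_{ij}\rho^{(k)}_{ij}\big|$. The cost ratios are $c_1=0$ and $c_{k}=T_{k}/F_{k-1}$ for $k\ge2$ (equivalently, $c_{k+1}=c\sum_{i,j}|(1-c_{k+1})\psi^{(k+1)}_{ij}-\psi'^{(k)}_{ij}|$). Algorithms. Starting from a portfolio matrix $\psi^{(1)}$, for $k=1,\dots,N$: IITC: $\displaystyle \psi^{(k+1)}_{ij}=\frac{\psi'^{(k)}_{ij}\exp(\gamma\rho'^{(k+1)}_{ij})}{\sum_{v,l=1}^m\psi'^{(k)}_{vl}\exp(\gamma\rho'^{(k+1)}_{vl})}$; EIITC: $\displaystyle \psi^{(k+1)}_{ij}=\frac{\psi'^{(k)}_{ij}\exp\big(\gamma\rho'^{(k+1)}_{ij}/(\psi'^{(k)}\diamond R'^{(k+1)})\big)}{\sum_{v,l=1}^m\psi'^{(k)}_{vl}\exp\big(\gamma\rho'^{(k+1)}_{vl}/(\psi'^{(k)}\diamond R'^{(k+1)})\big)}$. Growth rates. With transaction costs: $R_N(\{\psi^{(k)}\},\{R^{(k)}\})=\frac1N\sum_{k=1}^N\log(\psi^{(k)}\diamond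 R^{(k)})+\frac1N\sum_{k=1}^N\log(1-c_k)$. For investing only in the pair $(i,j)$: $R^*_N(e_{ij},\{R^{(k)}\})=\frac1N\sum_{k=1}^N\log(e_{ij}\diamond R^{(k)})$. *)

theory Defs
  imports "HOL-Analysis.Analysis"
begin

text \<open>The currencies are the elements of a finite type \<open>'m\<close>. A return matrix is the pair of its
  buying and its selling returns, so that linear combinations of return matrices are those of the
  product vector space.\<close>

type_synonym 'm return_matrix = "(real ^ 'm ^ 'm) \<times> (real ^ 'm ^ 'm)"

definition is_return_matrix :: "'m::finite return_matrix \<Rightarrow> bool" where
  "is_return_matrix R \<longleftrightarrow>
     (\<forall>i j. fst R $ i $ j \<ge> 0 \<and> snd R $ i $ j \<ge> 0) \<and>
     (\<forall>i. fst R $ i $ i = 0 \<and> snd R $ i $ i = 0)"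

definition total_return :: "'m::finite return_matrix \<Rightarrow> 'm \<Rightarrow> 'm \<Rightarrow> real" where
  "total_return R i j = fst R $ i $ j + snd R $ i $ j"

definition is_portfolio :: "real ^ 'm::finite ^ 'm \<Rightarrow> bool" where
  "is_portfolio \<psi> \<longleftrightarrow>
     (\<forall>i. \<psi> $ i $ i = 0) \<and> (\<forall>i j. i \<noteq> j \<longrightarrow> \<psi> $ i $ j > 0) \<and>
     (\<Sum>i\<in>UNIV. \<Sum>j\<in>UNIV. \<psi> $ i $ j) = 1"

definition diamond :: "real ^ 'm::finite ^ 'm \<Rightarrow> 'm return_matrix \<Rightarrow> real" (infixl "\<diamondop>" 70) where
  "\<psi> \<diamondop> R = (\<Sum>i\<in>UNIV. \<Sum>j\<in>UNIV. \<psi> $ i $ j * total_return R i j)"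

definition unit_matrix :: "'m::finite \<Rightarrow> 'm \<Rightarrow> real ^ 'm ^ 'm" where
  "unit_matrix i j = (\<chi> v l. if v = i \<and> l = j then 1 else 0)"

text \<open>The proportions automatically reached at the end of a day that was begun with \<open>\<psi>\<close>.\<close>

definition end_of_day :: "real ^ 'm::finite ^ 'm \<Rightarrow> 'm return_matrix \<Rightarrow> real ^ 'm ^ 'm" where
  "end_of_day \<psi> R = (\<chi> i j. \<psi> $ i $ j * total_return R i j / (\<psi> \<diamondop> R))"

text \<open>In the two algorithms \<open>R' (k + 1)\<close> is the prediction for day \<open>k + 1\<close>; all sequences are
  indexed from \<open>1\<close>, their values at \<open>0\<close> being irrelevant.\<close>

definition is_IITC ::
  "nat \<Rightarrow> real \<Rightarrow> (nat \<Rightarrow> 'm::finite return_matrix) \<Rightarrow> (nat \<Rightarrow> 'm return_matrix) \<Rightarrow>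
   real ^ 'm ^ 'm \<Rightarrow> (nat \<Rightarrow> real ^ 'm ^ 'm) \<Rightarrow> bool" where
  "is_IITC N \<gamma> R R' \<psi>\<^sub>1 \<psi> \<longleftrightarrow> \<psi> 1 = \<psi>\<^sub>1 \<and>
     (\<forall>k\<in>{1..N}. \<forall>i j. \<psi> (k + 1) $ i $ j =
        (let \<psi>' = end_of_day (\<psi> k) (R k) in
          \<psi>' $ i $ j * exp (\<gamma> * total_return (R' (k + 1)) i j) /
          (\<Sum>v\<in>UNIV. \<Sum>l\<in>UNIV. \<psi>' $ v $ l * exp (\<gamma> * total_return (R' (k + 1)) v l))))"

definition is_EIITC ::
  "nat \<Rightarrow> real \<Rightarrow> (nat \<Rightarrow> 'm::finite return_matrix) \<Rightarrow> (nat \<Rightarrow> 'm return_matrix) \<Rightarrow>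
   real ^ 'm ^ 'm \<Rightarrow> (nat \<Rightarrow> real ^ 'm ^ 'm) \<Rightarrow> bool" where
  "is_EIITC N \<gamma> R R' \<psi>\<^sub>1 \<psi> \<longleftrightarrow> \<psi> 1 = \<psi>\<^sub>1 \<and>
     (\<forall>k\<in>{1..N}. \<forall>i j. \<psi> (k + 1) $ i $ j =
        (let \<psi>' = end_of_day (\<psi> k) (R k) in
          \<psi>' $ i $ j * exp (\<gamma> * total_return (R' (k + 1)) i j / (\<psi>' \<diamondop> R' (k + 1))) /
          (\<Sum>v\<in>UNIV. \<Sum>l\<in>UNIV. \<psi>' $ v $ l *
             exp (\<gamma> * total_return (R' (k + 1)) v l / (\<psi>' \<diamondop> R' (k + 1))))))"

text \<open>\<open>F k\<close> is the capital at the end of day \<open>k\<close> (\<open>F 0\<close> the initial one), \<open>T k\<close> the transaction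
  cost charged at day \<open>k\<close>.\<close>

definition net_capital :: "(nat \<Rightarrow> real) \<Rightarrow> (nat \<Rightarrow> real) \<Rightarrow> nat \<Rightarrow> real" where
  "net_capital F T k = F (k - 1) - T k"

text \<open>The equation for \<open>T (k + 1)\<close> is implicit, since \<open>T (k + 1)\<close> also occurs in
  \<open>net_capital F T (k + 1)\<close>; as \<open>0 < c < 1\<close>, it has exactly one solution. It involves no return of
  day \<open>k + 1\<close>, so it makes sense up to \<open>k = N\<close>.\<close>

definition is_capital_process ::
  "nat \<Rightarrow> real \<Rightarrow> (nat \<Rightarrow> 'm::finite return_matrix) \<Rightarrow> (nat \<Rightarrow> real ^ 'm ^ 'm) \<Rightarrow>
   (nat \<Rightarrow> real) \<Rightarrow> (nat \<Rightarrow> real) \<Rightarrow> bool" where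
  "is_capital_process N c R \<psi> F T \<longleftrightarrow>
     (\<forall>k\<in>{0..N}. F k > 0) \<and>
     (\<forall>k\<in>{1..N}.
        \<psi> k \<diamondop> R k > 0 \<and>
        F k = net_capital F T k * (\<psi> k \<diamondop> R k) \<and>
        T (k + 1) = c * (\<Sum>i\<in>UNIV. \<Sum>j\<in>UNIV.
          \<bar>net_capital F T (k + 1) * \<psi> (k + 1) $ i $ j
            - net_capital F T k * \<psi> k $ i $ j * total_return (R k) i j\<bar>))"

definition cost_ratio :: "(nat \<Rightarrow> real) \<Rightarrow> (nat \<Rightarrow> real) \<Rightarrow> nat \<Rightarrow> real" where
  "cost_ratio F T k = (if k = 1 then 0 else T k / F (k - 1))"

definition growth_rate ::
  "nat \<Rightarrow> (nat \<Rightarrow> real ^ 'm::finite ^ 'm) \<Rightarrow> (nat \<Rightarrow> 'm return_matrix) \<Rightarrow> (nat \<Rightarrow> real) \<Rightarrow> real" where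
  "growth_rate N \<psi> R cr =
     1 / real N * (\<Sum>k=1..N. ln (\<psi> k \<diamondop> R k)) + 1 / real N * (\<Sum>k=1..N. ln (1 - cr k))"

definition fixed_growth_rate ::
  "nat \<Rightarrow> real ^ 'm::finite ^ 'm \<Rightarrow> (nat \<Rightarrow> 'm return_matrix) \<Rightarrow> real" where
  "fixed_growth_rate N e R = 1 / real N * (\<Sum>k=1..N. ln (e \<diamondop> R k))"

text \<open>\<open>g(\<gamma>) = O(\<gamma>\<^sup>2)\<close> as \<open>\<gamma>\<close> tends to \<open>0\<close> from the right.\<close>

definition is_O_square :: "(real \<Rightarrow> real) \<Rightarrow> bool" where
  "is_O_square g \<longleftrightarrow>
     (\<exists>\<alpha>\<^sub>1 \<alpha>\<^sub>2. \<forall>\<^sub>F \<gamma> in at_right 0. \<alpha>\<^sub>1 * \<gamma>\<^sup>2 \<le> g \<gamma> \<and> g \<gamma> \<le> \<alpha>\<^sub>2 * \<gamma>\<^sup>2)"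

end

theory Submission
  imports Defs
begin

text \<open>Both algorithms are exponential reweightings of the proportions \<open>\<psi>'\<close> reached at the end of
  the day, with exponents in \<open>[b, B]\<close> off the diagonal. The normalizer lies in \<open>[1, exp B]\<close>, so every
  step changes the logarithm of the \<open>(i, j)\<close> entry by \<open>ln (\<rho>\<^sub>i\<^sub>j / (\<psi> \<diamondop> R))\<close> plus at least
  \<open>b - B\<close>; summing over the days telescopes to the growth-rate bounds. Moreover
  every entry changes by at most the fraction \<open>exp B - 1 \<le> B * exp B\<close>, and solving the implicit
  equation for the cost ratio costs a factor \<open>c / (1 - c)\<close>. So the cost bounds hold
  for every \<open>\<gamma> > 0\<close>, with a vanishing \<open>O(\<gamma>\<^sup>2)\<close> term.\<close>

section \<open>Portfolios as probability weights on ordered pairs of currencies\<close>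

lemma portfolio_nonneg: "is_portfolio \<psi> \<Longrightarrow> \<psi> $ i $ j \<ge> 0"
  unfolding is_portfolio_def by (cases "i = j") (auto intro: less_imp_le)

text \<open>The entries of a portfolio are weights of total 1 that vanish on the diagonal, so the
  sum is a mean of off-diagonal values. Leaving \<open>f i i\<close> free matters: diagonal returns
  are 0 and would violate the lower bound \<open>r\<close>.\<close>

lemma portfolio_sum_le:
  assumes p: "is_portfolio \<psi>" and "\<And>i j. i \<noteq> j \<Longrightarrow> f i j \<le> u"
  shows "(\<Sum>i\<in>UNIV. \<Sum>j\<in>UNIV. \<psi> $ i $ j * f i j) \<le> u"
proof -
  have "\<psi> $ i $ j * f i j \<le> \<psi> $ i $ j * u" for i j
    using assms portfolio_nonneg[OF p]
    by (cases "i = j") (auto simp: is_portfolio_def intro: mult_left_mono)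
  then have "(\<Sum>i\<in>UNIV. \<Sum>j\<in>UNIV. \<psi> $ i $ j * f i j) \<le> (\<Sum>i\<in>UNIV. \<Sum>j\<in>UNIV. \<psi> $ i $ j * u)"
    by (intro sum_mono)
  also have "\<dots> = u"
    using p by (simp add: is_portfolio_def flip: sum_distrib_right)
  finally show ?thesis .
qed

lemma portfolio_sum_ge:
  assumes "is_portfolio \<psi>" and "\<And>i j. i \<noteq> j \<Longrightarrow> u \<le> f i j"
  shows "u \<le> (\<Sum>i\<in>UNIV. \<Sum>j\<in>UNIV. \<psi> $ i $ j * f i j)"
  using portfolio_sum_le[OF assms(1), of "\<lambda>i j. - f i j" "- u"] assms(2)
  by (simp add: sum_negf)

lemma diamond_unit_matrix: "unit_matrix i j \<diamondop> R = total_return R i j"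
proof -
  have "(\<Sum>l\<in>UNIV. unit_matrix i j $ v $ l * total_return R v l)
      = (if v = i then total_return R i j else 0)" for v
    by (cases "v = i") (simp_all add: unit_matrix_def if_distrib[of "\<lambda>x. x * _"] cong: if_cong)
  then show ?thesis
    by (simp add: diamond_def)
qed

lemma end_of_day_portfolio:
  assumes "is_portfolio \<psi>" "\<psi> \<diamondop> R > 0" "\<And>i j. i \<noteq> j \<Longrightarrow> total_return R i j > 0"
  shows "is_portfolio (end_of_day \<psi> R)"
  unfolding is_portfolio_def
proof (intro conjI allI impI)
  show "(\<Sum>i\<in>UNIV. \<Sum>j\<in>UNIV. end_of_day \<psi> R $ i $ j) = 1"
    using assms(2) by (simp add: end_of_day_def diamond_def flip: sum_divide_distrib)
qed (use assms in \<open>auto simp: end_of_day_def is_portfolio_def\<close>)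

section \<open>Exponential reweighting of a portfolio\<close>

definition normalizer :: "real ^ 'm::finite ^ 'm \<Rightarrow> ('m \<Rightarrow> 'm \<Rightarrow> real) \<Rightarrow> real" where
  "normalizer q x = (\<Sum>v\<in>UNIV. \<Sum>l\<in>UNIV. q $ v $ l * exp (x v l))"

text \<open>This is the multiplicative-weights (exponentiated gradient) update. With arbitrary
  exponents \<open>x\<close> it covers both algorithms, which differ only in the choice of
  \<open>x\<close>.\<close>

definition exp_reweight :: "real ^ 'm::finite ^ 'm \<Rightarrow> ('m \<Rightarrow> 'm \<Rightarrow> real) \<Rightarrow> real ^ 'm ^ 'm" where
  "exp_reweight q x = (\<chi> i j. q $ i $ j * exp (x i j) / normalizer q x)"

text \<open>The least of the finitely many exponents yields a positive lower bound of the mean. Thus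
  reweighting preserves portfolios for arbitrary exponents; the exponent bounds of EIITC are in turn
  derived from the portfolio property.\<close>

lemma normalizer_pos:
  assumes "is_portfolio q"
  shows "normalizer q x > 0"
proof -
  let ?l = "Min (range (\<lambda>(v, l). x v l))"
  have "?l \<le> x v l" for v l
    by (rule Min_le) (auto intro!: image_eqI[of _ _ "(v, l)"])
  then have "exp ?l \<le> normalizer q x"
    unfolding normalizer_def by (intro portfolio_sum_ge[OF assms]) simp
  then show ?thesis
    using less_le_trans[OF exp_gt_zero] by blast
qed

lemma normalizer_bounds:
  assumes "is_portfolio q" "\<And>i j. i \<noteq> j \<Longrightarrow> 0 \<le> x i j" "\<And>i j. i \<noteq> j \<Longrightarrow> x i j \<le> B"
  shows "1 \<le> normalizer q x" "normalizer q x \<le> exp B"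
  unfolding normalizer_def
  using assms by (auto intro: portfolio_sum_ge portfolio_sum_le)

lemma exp_reweight_portfolio:
  assumes "is_portfolio q"
  shows "is_portfolio (exp_reweight q x)"
  unfolding is_portfolio_def
proof (intro conjI allI impI)
  have "(\<Sum>i\<in>UNIV. \<Sum>j\<in>UNIV. exp_reweight q x $ i $ j) = normalizer q x / normalizer q x"
    by (simp add: exp_reweight_def normalizer_def flip: sum_divide_distrib)
  then show "(\<Sum>i\<in>UNIV. \<Sum>j\<in>UNIV. exp_reweight q x $ i $ j) = 1"
    using normalizer_pos[OF assms, of x] by simp
qed (use assms normalizer_pos[OF assms, of x] in \<open>auto simp: exp_reweight_def is_portfolio_def\<close>)

text \<open>Each entry of \<open>q\<close> is multiplied by
  \<open>exp (x i j) / normalizer q x\<close>, a factor between \<open>exp (- B)\<close> and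
  \<open>exp B\<close> and hence within \<open>B * exp B\<close> of 1. Averaging this deviation with
  the weights \<open>q\<close> gives the l1 distance.\<close>

lemma exp_reweight_dist_le:
  assumes q: "is_portfolio q"
    and x: "\<And>i j. i \<noteq> j \<Longrightarrow> 0 \<le> x i j" "\<And>i j. i \<noteq> j \<Longrightarrow> x i j \<le> B"
  shows "(\<Sum>i\<in>UNIV. \<Sum>j\<in>UNIV. \<bar>exp_reweight q x $ i $ j - q $ i $ j\<bar>) \<le> B * exp B"
proof -
  let ?Z = "normalizer q x"
  have Z: "1 \<le> ?Z" "?Z \<le> exp B"
    using normalizer_bounds[where x = x and B = B, OF q x] by auto
  have "\<bar>exp (x i j) / ?Z - 1\<bar> \<le> B * exp B" if "i \<noteq> j" for i j
  proof -
    \<comment> \<open>The sign of \<open>B\<close> is read off from an off-diagonal exponent, hence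
      inside this claim.\<close>
    have B: "0 \<le> B"
      using x[OF that] by linarith
    \<comment> \<open>This inequality serves twice: as it stands it bounds the downward deviation by
      \<open>B\<close>, and multiplied by \<open>exp B\<close> it bounds the upward one by
      \<open>B * exp B\<close>.\<close>
    have "1 - B \<le> exp (- B)"
      using exp_ge_add_one_self[of "- B"] by simp
    then have "(1 - B) * exp B \<le> exp (- B) * exp B"
      by (rule mult_right_mono) simp
    then have e: "exp B - 1 \<le> B * exp B"
      by (simp add: algebra_simps flip: exp_add)
    have "exp (x i j) / ?Z \<le> exp B / 1"
      using x[OF that] Z by (intro frac_le) auto
    moreover have "exp (- B) = 1 / exp B"
      by (simp add: exp_minus field_simps)
    then have "exp (- B) \<le> exp (x i j) / ?Z"
      using x[OF that] Z frac_le[of "exp (x i j)" 1 ?Z "exp B"] by simp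
    moreover have "B \<le> B * exp B"
      using B by (simp add: mult_le_cancel_left1)
    ultimately show ?thesis
      using e \<open>1 - B \<le> exp (- B)\<close> by linarith
  qed
  then have "(\<Sum>i\<in>UNIV. \<Sum>j\<in>UNIV. q $ i $ j * \<bar>exp (x i j) / ?Z - 1\<bar>) \<le> B * exp B"
    by (rule portfolio_sum_le[OF q])
  moreover have "\<bar>exp_reweight q x $ i $ j - q $ i $ j\<bar> = q $ i $ j * \<bar>exp (x i j) / ?Z - 1\<bar>" for i j
  proof -
    have "exp_reweight q x $ i $ j - q $ i $ j = q $ i $ j * (exp (x i j) / ?Z - 1)"
      by (simp add: exp_reweight_def algebra_simps)
    then show ?thesis
      using portfolio_nonneg[OF q, of i j] by (simp add: abs_mult)
  qed
  ultimately show ?thesis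
    by simp
qed

section \<open>Growth rate under repeated reweighting\<close>

lemma reweighted_portfolios:
  fixes k N :: nat
  assumes "is_portfolio (\<psi> 1)"
    and step: "\<And>k. k \<in> {1..N} \<Longrightarrow> \<psi> (k + 1) = exp_reweight (end_of_day (\<psi> k) (R k)) (x k)"
    and "\<And>k. k \<in> {1..N} \<Longrightarrow> \<psi> k \<diamondop> R k > 0"
    and "\<And>k i j. k \<in> {1..N} \<Longrightarrow> i \<noteq> j \<Longrightarrow> total_return (R k) i j > 0"
  shows "k \<in> {1..N + 1} \<Longrightarrow> is_portfolio (\<psi> k)"
proof (induction k)
  case (Suc k)
  show ?case
  \<comment> \<open>Days are counted from 1, so the base case of the recursion is the successor of
    0.\<close>
  proof (cases "k = 0")
    case False
    then have "k \<in> {1..N}" "k \<in> {1..N + 1}"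
      using Suc.prems by auto
    then show ?thesis
      using step[of k] Suc.IH assms(3,4)
      by (auto intro!: exp_reweight_portfolio end_of_day_portfolio)
  qed (use assms(1) in simp)
qed simp

text \<open>The logarithm of one update is a sum in which the exponent is at least \<open>b\<close>
  and the logarithm of the normalizer at most \<open>B\<close>; the portfolio terms telescope over
  the days. The cost term is the same on both sides, so \<open>cr\<close> can be any
  sequence.\<close>

lemma reweighted_growth_rate_ge:
  assumes N: "N \<ge> 1"
    and portfolio: "\<And>k. k \<in> {1..N + 1} \<Longrightarrow> is_portfolio (\<psi> k)"
    and step: "\<And>k. k \<in> {1..N} \<Longrightarrow> \<psi> (k + 1) = exp_reweight (end_of_day (\<psi> k) (R k)) (x k)"
    and pos: "\<And>k. k \<in> {1..N} \<Longrightarrow> \<psi> k \<diamondop> R k > 0"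
    and returns: "\<And>k i j. k \<in> {1..N} \<Longrightarrow> i \<noteq> j \<Longrightarrow> total_return (R k) i j > 0"
    and b: "0 \<le> b" "\<And>k i j. k \<in> {1..N} \<Longrightarrow> i \<noteq> j \<Longrightarrow> b \<le> x k i j"
    and B: "\<And>k i j. k \<in> {1..N} \<Longrightarrow> i \<noteq> j \<Longrightarrow> x k i j \<le> B"
    and ij: "i \<noteq> j"
  shows "growth_rate N \<psi> R cr - fixed_growth_rate N (unit_matrix i j) R
    \<ge> 1 / real N * ln (\<psi> 1 $ i $ j / \<psi> (N + 1) $ i $ j)
      + 1 / real N * (\<Sum>k=1..N. ln (1 - cr k)) + b - B"
proof -
  have pp: "\<psi> k $ i $ j > 0" if "k \<in> {1..N + 1}" for k
    using portfolio[OF that] ij by (simp add: is_portfolio_def)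
  have "ln (\<psi> k \<diamondop> R k) - ln (total_return (R k) i j)
      \<ge> (ln (\<psi> k $ i $ j) - ln (\<psi> (k + 1) $ i $ j)) + (b - B)" if k: "k \<in> {1..N}" for k
  proof -
    let ?q = "end_of_day (\<psi> k) (R k)"
    let ?Z = "normalizer ?q (x k)"
    have q: "is_portfolio ?q"
      using k portfolio pos returns by (intro end_of_day_portfolio) auto
    have x: "0 \<le> x k v l" "x k v l \<le> B" if "v \<noteq> l" for v l
      using b(2)[OF k that] b(1) B[OF k that] by auto
    have Z: "1 \<le> ?Z" "?Z \<le> exp B"
      using normalizer_bounds[OF q x] by auto
    have "\<psi> (k + 1) $ i $ j
        = \<psi> k $ i $ j * total_return (R k) i j / (\<psi> k \<diamondop> R k) * exp (x k i j) / ?Z"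
      unfolding step[OF k] by (simp add: exp_reweight_def end_of_day_def)
    then have "ln (\<psi> (k + 1) $ i $ j) = ln (\<psi> k $ i $ j) + ln (total_return (R k) i j)
        - ln (\<psi> k \<diamondop> R k) + x k i j - ln ?Z"
      using pp[of k] k Z pos[OF k] returns[OF k ij] by (simp add: ln_div ln_mult)
    moreover have "ln ?Z \<le> B"
      using Z ln_mono[of ?Z "exp B"] by simp
    ultimately show ?thesis
      using b(2)[OF k ij] by linarith
  qed
  then have "(\<Sum>k=1..N. ln (\<psi> k \<diamondop> R k) - ln (total_return (R k) i j))
      \<ge> (\<Sum>k=1..N. (ln (\<psi> k $ i $ j) - ln (\<psi> (k + 1) $ i $ j)) + (b - B))"
    by (intro sum_mono)
  \<comment> \<open>The differences run from \<open>k\<close> to \<open>k + 1\<close> with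
    decreasing sign, so the telescoping rule is applied to the negated logarithms.\<close>
  moreover have "(\<Sum>k=1..N. ln (\<psi> k $ i $ j) - ln (\<psi> (k + 1) $ i $ j))
      = ln (\<psi> 1 $ i $ j) - ln (\<psi> (N + 1) $ i $ j)"
    using sum_Suc_diff[of 1 N "\<lambda>k. - ln (\<psi> k $ i $ j)"] N by simp
  moreover have "\<dots> = ln (\<psi> 1 $ i $ j / \<psi> (N + 1) $ i $ j)"
    using pp[of 1] pp[of "N + 1"] by (simp add: ln_div)
  ultimately have "ln (\<psi> 1 $ i $ j / \<psi> (N + 1) $ i $ j) + real N * (b - B)
      \<le> (\<Sum>k=1..N. ln (\<psi> k \<diamondop> R k)) - (\<Sum>k=1..N. ln (total_return (R k) i j))"
    by (simp add: sum.distrib sum_subtractf)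
  then have "1 / real N * (ln (\<psi> 1 $ i $ j / \<psi> (N + 1) $ i $ j) + real N * (b - B))
      \<le> 1 / real N * ((\<Sum>k=1..N. ln (\<psi> k \<diamondop> R k)) - (\<Sum>k=1..N. ln (total_return (R k) i j)))"
    by (intro mult_left_mono) auto
  then show ?thesis
    using N by (simp add: growth_rate_def fixed_growth_rate_def diamond_unit_matrix
        distrib_left right_diff_distrib)
qed

section \<open>Transaction cost ratios\<close>

text \<open>As \<open>(1 - s) * p - q\<close> is \<open>(p - q) - s * p\<close> and \<open>p\<close>
  has l1 norm 1, the triangle inequality bounds \<open>s\<close> by \<open>c\<close> times the sum
  of the l1 distance and \<open>s\<close>. Since \<open>c < 1\<close>, this can be solved for
  \<open>s\<close>.\<close>

lemma implicit_cost_le: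
  assumes c: "0 < c" "c < 1" and p: "is_portfolio p"
    and s: "s = c * (\<Sum>i\<in>UNIV. \<Sum>j\<in>UNIV. \<bar>(1 - s) * p $ i $ j - q $ i $ j\<bar>)"
  shows "s \<le> c * (\<Sum>i\<in>UNIV. \<Sum>j\<in>UNIV. \<bar>p $ i $ j - q $ i $ j\<bar>) / (1 - c)"
proof -
  \<comment> \<open>The equation itself exhibits \<open>s\<close> as a nonnegative multiple of a sum
    of absolute values.\<close>
  have "s \<ge> 0"
    using c by (subst s) (auto intro!: mult_nonneg_nonneg sum_nonneg)
  have "\<bar>(1 - s) * p $ i $ j - q $ i $ j\<bar> \<le> \<bar>p $ i $ j - q $ i $ j\<bar> + p $ i $ j * s" for i j
    using mult_nonneg_nonneg[OF portfolio_nonneg[OF p, of i j] \<open>s \<ge> 0\<close>]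
    by (auto simp: algebra_simps)
  then have "(\<Sum>i\<in>UNIV. \<Sum>j\<in>UNIV. \<bar>(1 - s) * p $ i $ j - q $ i $ j\<bar>)
      \<le> (\<Sum>i\<in>UNIV. \<Sum>j\<in>UNIV. \<bar>p $ i $ j - q $ i $ j\<bar> + p $ i $ j * s)"
    by (intro sum_mono)
  also have "\<dots> = (\<Sum>i\<in>UNIV. \<Sum>j\<in>UNIV. \<bar>p $ i $ j - q $ i $ j\<bar>) + s"
    using p by (simp add: sum.distrib is_portfolio_def flip: sum_distrib_right)
  finally have "s \<le> c * ((\<Sum>i\<in>UNIV. \<Sum>j\<in>UNIV. \<bar>p $ i $ j - q $ i $ j\<bar>) + s)"
    using c by (subst s) (auto intro: mult_left_mono)
  then show ?thesis
    using c by (simp add: field_simps)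
qed

text \<open>The cost equation is homogeneous in the capital: dividing by \<open>F k\<close>
  normalizes it, because the holdings before rebalancing are \<open>F k\<close> times the end-of-day
  proportions.\<close>

lemma cost_ratio_equation:
  assumes cap: "is_capital_process N c R \<psi> F T" and k: "k \<in> {1..N}"
  defines "s \<equiv> cost_ratio F T (k + 1)"
  shows "s = c * (\<Sum>i\<in>UNIV. \<Sum>j\<in>UNIV.
    \<bar>(1 - s) * \<psi> (k + 1) $ i $ j - end_of_day (\<psi> k) (R k) $ i $ j\<bar>)"
proof -
  have F: "F k > 0"
    using cap k unfolding is_capital_process_def by force
  have D: "\<psi> k \<diamondop> R k > 0" and Fk: "F k = net_capital F T k * (\<psi> k \<diamondop> R k)"
    and T: "T (k + 1) = c * (\<Sum>i\<in>UNIV. \<Sum>j\<in>UNIV.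
          \<bar>net_capital F T (k + 1) * \<psi> (k + 1) $ i $ j
            - net_capital F T k * \<psi> k $ i $ j * total_return (R k) i j\<bar>)"
    using cap k unfolding is_capital_process_def by blast+
  \<comment> \<open>The convention for day 1 does not interfere, as \<open>k + 1\<close> is at least
    2.\<close>
  have s: "s = T (k + 1) / F k"
    using k by (simp add: s_def cost_ratio_def)
  have 1: "net_capital F T (k + 1) = F k * (1 - s)"
    using F by (simp add: s net_capital_def field_simps)
  have 2: "net_capital F T k = F k / (\<psi> k \<diamondop> R k)"
    using D Fk by simp
  have "\<bar>net_capital F T (k + 1) * \<psi> (k + 1) $ i $ j
        - net_capital F T k * \<psi> k $ i $ j * total_return (R k) i j\<bar>
      = F k * \<bar>(1 - s) * \<psi> (k + 1) $ i $ j - end_of_day (\<psi> k) (R k) $ i $ j\<bar>" for i j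
  proof -
    have "net_capital F T (k + 1) * \<psi> (k + 1) $ i $ j
        - net_capital F T k * \<psi> k $ i $ j * total_return (R k) i j
      = F k * ((1 - s) * \<psi> (k + 1) $ i $ j - end_of_day (\<psi> k) (R k) $ i $ j)"
      unfolding 1 2 by (simp add: end_of_day_def algebra_simps)
    then show ?thesis
      using F by (simp add: abs_mult)
  qed
  then have "T (k + 1) = F k * (c * (\<Sum>i\<in>UNIV. \<Sum>j\<in>UNIV.
      \<bar>(1 - s) * \<psi> (k + 1) $ i $ j - end_of_day (\<psi> k) (R k) $ i $ j\<bar>))"
    unfolding T by (simp add: mult.left_commute flip: sum_distrib_left)
  then have "T (k + 1) / F k = c * (\<Sum>i\<in>UNIV. \<Sum>j\<in>UNIV.
      \<bar>(1 - s) * \<psi> (k + 1) $ i $ j - end_of_day (\<psi> k) (R k) $ i $ j\<bar>)"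
    using F by simp
  then show ?thesis
    unfolding s[symmetric] .
qed

text \<open>The implicit equation reduces the cost to the l1 distance between the new portfolio and
  the end-of-day proportions, which the reweighting bound controls.\<close>

lemma reweighted_cost_ratio_le:
  assumes c: "0 < c" "c < 1" and cap: "is_capital_process N c R \<psi> F T" and k: "k \<in> {1..N}"
    and step: "\<psi> (k + 1) = exp_reweight (end_of_day (\<psi> k) (R k)) x"
    and q: "is_portfolio (end_of_day (\<psi> k) (R k))"
    and x: "\<And>i j. i \<noteq> j \<Longrightarrow> 0 \<le> x i j" "\<And>i j. i \<noteq> j \<Longrightarrow> x i j \<le> B"
  shows "cost_ratio F T (k + 1) \<le> c * (B * exp B) / (1 - c)"
proof -
  have "is_portfolio (\<psi> (k + 1))"
    unfolding step using q by (rule exp_reweight_portfolio)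
  from implicit_cost_le[OF c this cost_ratio_equation[OF cap k]]
  show ?thesis
    using exp_reweight_dist_le[where B = B, OF q x] c unfolding step
    by (elim order_trans) (auto intro!: divide_right_mono mult_left_mono)
qed

section \<open>Linear predictions\<close>

lemma total_return_sum_scaleR:
  "total_return (\<Sum>l\<in>A. a l *\<^sub>R R l) i j = (\<Sum>l\<in>A. a l * total_return (R l) i j)"
  by (induction A rule: infinite_finite_induct)
    (simp_all add: total_return_def algebra_simps)

text \<open>By linearity of \<open>total_return\<close>, the predicted value is a convex combination
  of past ones and stays in any interval containing them.\<close>

lemma prediction_bounds:
  assumes "\<And>l. l \<in> A \<Longrightarrow> a l \<ge> 0" "sum a A = 1"
    and "\<And>l. l \<in> A \<Longrightarrow> r \<le> total_return (R l) i j \<and> total_return (R l) i j \<le> u"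
  shows "r \<le> total_return (\<Sum>l\<in>A. a l *\<^sub>R R l) i j" "total_return (\<Sum>l\<in>A. a l *\<^sub>R R l) i j \<le> u"
proof -
  have "(\<Sum>l\<in>A. a l * r) \<le> (\<Sum>l\<in>A. a l * total_return (R l) i j)"
    "(\<Sum>l\<in>A. a l * total_return (R l) i j) \<le> (\<Sum>l\<in>A. a l * u)"
    using assms by (auto intro!: sum_mono mult_left_mono)
  then show "r \<le> total_return (\<Sum>l\<in>A. a l *\<^sub>R R l) i j" "total_return (\<Sum>l\<in>A. a l *\<^sub>R R l) i j \<le> u"
    using assms(2) by (simp_all add: total_return_sum_scaleR flip: sum_distrib_right)
qed

section \<open>The two algorithms as instances of exponential reweighting\<close>

theorem theorem5p2:
  fixes R R' :: "nat \<Rightarrow> 'm::finite return_matrix"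
    and \<psi>\<^sub>1 :: "real ^ 'm ^ 'm"
    and d :: "nat \<Rightarrow> nat" and a :: "nat \<Rightarrow> nat \<Rightarrow> real"
    and N :: nat and c r :: real and i j :: 'm
  assumes m: "CARD('m) > 1"
    and N: "N \<ge> 1"
    and c: "0 < c" "c < 1"
    and r: "0 < r" "r < 1"
    and returns: "\<And>k. k \<in> {1..N} \<Longrightarrow> is_return_matrix (R k)"
    and lower: "\<And>k v l. k \<in> {1..N} \<Longrightarrow> v \<noteq> l \<Longrightarrow> total_return (R k) v l \<ge> r"
    and max: "\<And>k. k \<in> {1..N} \<Longrightarrow> Max {total_return (R k) v l | v l. True} = 1"
    and d: "\<And>k. k \<in> {1..N} \<Longrightarrow> 1 \<le> d k \<and> d k \<le> k"
    and a_nonneg: "\<And>k l. k \<in> {1..N} \<Longrightarrow> l \<in> {1..d k} \<Longrightarrow> a k l \<ge> 0"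
    and a_sum: "\<And>k. k \<in> {1..N} \<Longrightarrow> (\<Sum>l=1..d k. a k l) = 1"
    and prediction: "\<And>k. k \<in> {1..N} \<Longrightarrow>
          R' (k + 1) = (\<Sum>l=1..d k. a k l *\<^sub>R R (k - l + 1))"
    and start: "is_portfolio \<psi>\<^sub>1"
    and ij: "i \<noteq> j"
  shows
    "(\<forall>\<gamma>>0. \<forall>\<psi> F T. is_IITC N \<gamma> R R' \<psi>\<^sub>1 \<psi> \<longrightarrow> is_capital_process N c R \<psi> F T \<longrightarrow>
        growth_rate N \<psi> R (cost_ratio F T) - fixed_growth_rate N (unit_matrix i j) R
        \<ge> 1 / real N * ln (\<psi> 1 $ i $ j / \<psi> (N + 1) $ i $ j)
          + 1 / real N * (\<Sum>k=1..N. ln (1 - cost_ratio F T k)) + \<gamma> * r - \<gamma>) \<and>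
     (\<forall>\<gamma>>0. \<forall>\<psi> F T. is_EIITC N \<gamma> R R' \<psi>\<^sub>1 \<psi> \<longrightarrow> is_capital_process N c R \<psi> F T \<longrightarrow>
        growth_rate N \<psi> R (cost_ratio F T) - fixed_growth_rate N (unit_matrix i j) R
        \<ge> 1 / real N * ln (\<psi> 1 $ i $ j / \<psi> (N + 1) $ i $ j)
          + 1 / real N * (\<Sum>k=1..N. ln (1 - cost_ratio F T k)) + \<gamma> * r - \<gamma> / r) \<and>
     (\<forall>\<psi> F T. (\<forall>\<gamma>>0. is_IITC N \<gamma> R R' \<psi>\<^sub>1 (\<psi> \<gamma>) \<and>
                      is_capital_process N c R (\<psi> \<gamma>) (F \<gamma>) (T \<gamma>)) \<longrightarrow>
        (\<forall>k\<in>{1..N}. \<exists>g. is_O_square g \<and>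
          (\<forall>\<gamma>>0. cost_ratio (F \<gamma>) (T \<gamma>) (k + 1) \<le> c * exp \<gamma> * \<gamma> / (1 - c) + g \<gamma>))) \<and>
     (\<forall>\<psi> F T. (\<forall>\<gamma>>0. is_EIITC N \<gamma> R R' \<psi>\<^sub>1 (\<psi> \<gamma>) \<and>
                      is_capital_process N c R (\<psi> \<gamma>) (F \<gamma>) (T \<gamma>)) \<longrightarrow>
        (\<forall>k\<in>{1..N}. \<exists>g. is_O_square g \<and>
          (\<forall>\<gamma>>0. cost_ratio (F \<gamma>) (T \<gamma>) (k + 1) \<le> c * exp (\<gamma> / r) * \<gamma> / ((1 - c) * r) + g \<gamma>)))"
proof -
  have le1: "total_return (R k) v l \<le> 1" if "k \<in> {1..N}" for k v l
  proof -
    \<comment> \<open>Writing the set as an image of a finite type shows the finiteness that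
      \<open>Max_ge\<close> requires.\<close>
    have "{total_return (R k) v l | v l. True} = range (\<lambda>(v, l). total_return (R k) v l)"
      by auto
    then have "finite {total_return (R k) v l | v l. True}"
      by simp
    from Max_ge[OF this, of "total_return (R k) v l"] show ?thesis
      using max[OF that] by auto
  qed
  have pred: "r \<le> total_return (R' (k + 1)) v l" "total_return (R' (k + 1)) v l \<le> 1"
    if k: "k \<in> {1..N}" and "v \<noteq> l" for k v l
  proof -
    \<comment> \<open>Since \<open>l \<le> d k\<close> and \<open>d k \<le> k\<close>, the
      subtraction is not truncated, and only days from 1 to \<open>k\<close> enter the
      prediction.\<close>
    have "k - l + 1 \<in> {1..N}" if "l \<in> {1..d k}" for l
      using that k d[OF k] by auto
    then show "r \<le> total_return (R' (k + 1)) v l" "total_return (R' (k + 1)) v l \<le> 1"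
      unfolding prediction[OF k] using k \<open>v \<noteq> l\<close>
      by (auto intro!: prediction_bounds a_nonneg a_sum[OF k, simplified] lower le1)
  qed
  have pos: "total_return (R k) v l > 0" if "k \<in> {1..N}" "v \<noteq> l" for k v l
    using lower[OF that] r by linarith
  \<comment> \<open>The exponents of IITC (\<open>x\<close>) and of EIITC (\<open>y\<close>). The
    latter depend on the portfolios too, through the predicted return of the end-of-day
    proportions.\<close>
  define x where "x \<gamma> k v l = \<gamma> * total_return (R' (k + 1)) v l" for \<gamma> k v l
  define y where "y \<gamma> \<psi> k v l = \<gamma> * total_return (R' (k + 1)) v l /
      (end_of_day (\<psi> k) (R k) \<diamondop> R' (k + 1))" for \<gamma> \<psi> k v l
  have stepI: "\<psi> 1 = \<psi>\<^sub>1" "k \<in> {1..N} \<Longrightarrow> \<psi> (k + 1) = exp_reweight (end_of_day (\<psi> k) (R k)) (x \<gamma> k)"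
    if "is_IITC N \<gamma> R R' \<psi>\<^sub>1 \<psi>" for \<gamma> \<psi> k
    using that by (auto simp: is_IITC_def exp_reweight_def normalizer_def x_def Let_def vec_eq_iff)
  have stepE: "\<psi> 1 = \<psi>\<^sub>1" "k \<in> {1..N} \<Longrightarrow> \<psi> (k + 1) = exp_reweight (end_of_day (\<psi> k) (R k)) (y \<gamma> \<psi> k)"
    if "is_EIITC N \<gamma> R R' \<psi>\<^sub>1 \<psi>" for \<gamma> \<psi> k
    using that by (auto simp: is_EIITC_def exp_reweight_def normalizer_def y_def Let_def vec_eq_iff)
  have Dpos: "\<psi> k \<diamondop> R k > 0" if "is_capital_process N c R \<psi> F T" "k \<in> {1..N}" for \<psi> F T k
    using that by (simp add: is_capital_process_def)
  have portI: "is_portfolio (\<psi> k)"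
    if "is_IITC N \<gamma> R R' \<psi>\<^sub>1 \<psi>" "is_capital_process N c R \<psi> F T" "k \<in> {1..N + 1}" for \<gamma> \<psi> F T k
    by (rule reweighted_portfolios[where \<psi> = \<psi> and R = R and N = N and x = "x \<gamma>"])
      (use that stepI[OF that(1)] start pos Dpos[OF that(2)] in auto)
  have portE: "is_portfolio (\<psi> k)"
    if "is_EIITC N \<gamma> R R' \<psi>\<^sub>1 \<psi>" "is_capital_process N c R \<psi> F T" "k \<in> {1..N + 1}" for \<gamma> \<psi> F T k
    by (rule reweighted_portfolios[where \<psi> = \<psi> and R = R and N = N and x = "y \<gamma> \<psi>"])
      (use that stepE[OF that(1)] start pos Dpos[OF that(2)] in auto)
  have eodI: "is_portfolio (end_of_day (\<psi> k) (R k))"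
    if "is_IITC N \<gamma> R R' \<psi>\<^sub>1 \<psi>" "is_capital_process N c R \<psi> F T" "k \<in> {1..N}" for \<gamma> \<psi> F T k
    using that pos Dpos[OF that(2)] portI[OF that(1,2)] by (intro end_of_day_portfolio) auto
  have eodE: "is_portfolio (end_of_day (\<psi> k) (R k))"
    if "is_EIITC N \<gamma> R R' \<psi>\<^sub>1 \<psi>" "is_capital_process N c R \<psi> F T" "k \<in> {1..N}" for \<gamma> \<psi> F T k
    using that pos Dpos[OF that(2)] portE[OF that(1,2)] by (intro end_of_day_portfolio) auto
  have x: "\<gamma> * r \<le> x \<gamma> k v l" "x \<gamma> k v l \<le> \<gamma>" if "\<gamma> > 0" "k \<in> {1..N}" "v \<noteq> l" for \<gamma> k v l
    using that pred[OF that(2,3)] by (auto simp: x_def)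
  have y: "\<gamma> * r \<le> y \<gamma> \<psi> k v l" "y \<gamma> \<psi> k v l \<le> \<gamma> / r"
    if "\<gamma> > 0" "k \<in> {1..N}" "v \<noteq> l" "is_portfolio (end_of_day (\<psi> k) (R k))" for \<gamma> \<psi> k v l
  proof -
    let ?D = "end_of_day (\<psi> k) (R k) \<diamondop> R' (k + 1)"
    \<comment> \<open>The divisor is a mean of predicted returns. Being at most 1, it preserves the
      lower bound \<open>\<gamma> * r\<close>; being at least \<open>r\<close>, it raises the upper
      bound from \<open>\<gamma>\<close> to \<open>\<gamma> / r\<close>.\<close>
    have D: "r \<le> ?D" "?D \<le> 1"
      unfolding diamond_def
      using pred[OF that(2)] by (auto intro: portfolio_sum_ge portfolio_sum_le that(4))
    have "\<gamma> * r / 1 \<le> y \<gamma> \<psi> k v l"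
      unfolding y_def using that(1) r D pred[OF that(2,3)]
      by (intro frac_le) (auto intro: mult_left_mono)
    then show "\<gamma> * r \<le> y \<gamma> \<psi> k v l"
      by simp
    show "y \<gamma> \<psi> k v l \<le> \<gamma> / r"
      unfolding y_def using that(1) r D pred[OF that(2,3)]
      by (intro frac_le) auto
  qed
  have zero: "is_O_square (\<lambda>_. 0)"
    unfolding is_O_square_def by (intro exI[of _ 0]) simp
  show ?thesis
  proof (intro conjI allI impI ballI)
    fix \<gamma> :: real and \<psi> F T
    assume A: "\<gamma> > 0" "is_IITC N \<gamma> R R' \<psi>\<^sub>1 \<psi>" "is_capital_process N c R \<psi> F T"
    show "growth_rate N \<psi> R (cost_ratio F T) - fixed_growth_rate N (unit_matrix i j) R
        \<ge> 1 / real N * ln (\<psi> 1 $ i $ j / \<psi> (N + 1) $ i $ j)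
          + 1 / real N * (\<Sum>k=1..N. ln (1 - cost_ratio F T k)) + \<gamma> * r - \<gamma>"
      \<comment> \<open>Unification with the goal sets \<open>b\<close> to
        \<open>\<gamma> * r\<close> and \<open>B\<close> to \<open>\<gamma>\<close>.\<close>
      by (rule reweighted_growth_rate_ge[where x = "x \<gamma>"])
        (use A N r ij pos portI[OF A(2,3)] Dpos[OF A(3)] stepI[OF A(2)] x[OF A(1)] in auto)
  next
    fix \<gamma> :: real and \<psi> F T
    assume A: "\<gamma> > 0" "is_EIITC N \<gamma> R R' \<psi>\<^sub>1 \<psi>" "is_capital_process N c R \<psi> F T"
    show "growth_rate N \<psi> R (cost_ratio F T) - fixed_growth_rate N (unit_matrix i j) R
        \<ge> 1 / real N * ln (\<psi> 1 $ i $ j / \<psi> (N + 1) $ i $ j)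
          + 1 / real N * (\<Sum>k=1..N. ln (1 - cost_ratio F T k)) + \<gamma> * r - \<gamma> / r"
      by (rule reweighted_growth_rate_ge[where x = "y \<gamma> \<psi>"])
        (use A N r ij pos portE[OF A(2,3)] eodE[OF A(2,3)] Dpos[OF A(3)] stepE[OF A(2)]
          y[OF A(1)] in auto)
  next
    fix \<psi> F T k
    assume A: "\<forall>\<gamma>>0. is_IITC N \<gamma> R R' \<psi>\<^sub>1 (\<psi> \<gamma>) \<and> is_capital_process N c R (\<psi> \<gamma>) (F \<gamma>) (T \<gamma>)"
      and k: "k \<in> {1..N}"
    have "cost_ratio (F \<gamma>) (T \<gamma>) (k + 1) \<le> c * exp \<gamma> * \<gamma> / (1 - c)" if \<gamma>: "\<gamma> > 0" for \<gamma>
    proof -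
      have I: "is_IITC N \<gamma> R R' \<psi>\<^sub>1 (\<psi> \<gamma>)" and P: "is_capital_process N c R (\<psi> \<gamma>) (F \<gamma>) (T \<gamma>)"
        using A \<gamma> by auto
      \<comment> \<open>The cost bound is applied with \<open>B\<close> equal to
        \<open>\<gamma>\<close>; of the lower bound on the exponents only the sign is kept.\<close>
      have "0 \<le> x \<gamma> k v l" "x \<gamma> k v l \<le> \<gamma>" if "v \<noteq> l" for v l
        using x[OF \<gamma> k that] mult_pos_pos[OF \<gamma> r(1)] by auto
      from reweighted_cost_ratio_le[OF c P k stepI(2)[OF I k] eodI[OF I P k] this]
      show ?thesis
        by (simp add: mult_ac)
    qed
    with zero show "\<exists>g. is_O_square g \<and>
        (\<forall>\<gamma>>0. cost_ratio (F \<gamma>) (T \<gamma>) (k + 1) \<le> c * exp \<gamma> * \<gamma> / (1 - c) + g \<gamma>)"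
      by (intro exI[of _ "\<lambda>_. 0"]) simp
  next
    fix \<psi> F T k
    assume A: "\<forall>\<gamma>>0. is_EIITC N \<gamma> R R' \<psi>\<^sub>1 (\<psi> \<gamma>) \<and> is_capital_process N c R (\<psi> \<gamma>) (F \<gamma>) (T \<gamma>)"
      and k: "k \<in> {1..N}"
    have "cost_ratio (F \<gamma>) (T \<gamma>) (k + 1) \<le> c * exp (\<gamma> / r) * \<gamma> / ((1 - c) * r)" if \<gamma>: "\<gamma> > 0" for \<gamma>
    proof -
      have I: "is_EIITC N \<gamma> R R' \<psi>\<^sub>1 (\<psi> \<gamma>)" and P: "is_capital_process N c R (\<psi> \<gamma>) (F \<gamma>) (T \<gamma>)"
        using A \<gamma> by auto
      note q = eodE[OF I P k]
      \<comment> \<open>Here \<open>B\<close> is \<open>\<gamma> / r\<close>, whence both the factor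
        \<open>1 / r\<close> and the exponent in the final bound.\<close>
      have "0 \<le> y \<gamma> (\<psi> \<gamma>) k v l" "y \<gamma> (\<psi> \<gamma>) k v l \<le> \<gamma> / r" if "v \<noteq> l" for v l
        using y[where \<psi> = "\<psi> \<gamma>", OF \<gamma> k that q] mult_pos_pos[OF \<gamma> r(1)] by auto
      from reweighted_cost_ratio_le[OF c P k stepE(2)[OF I k] q this]
      show ?thesis
        by (simp add: mult_ac)
    qed
    with zero show "\<exists>g. is_O_square g \<and>
        (\<forall>\<gamma>>0. cost_ratio (F \<gamma>) (T \<gamma>) (k + 1) \<le> c * exp (\<gamma> / r) * \<gamma> / ((1 - c) * r) + g \<gamma>)"
      by (intro exI[of _ "\<lambda>_. 0"]) simp
  qed
qed

end
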